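(* Let $\lambda$ be a nonzero real number and $r$ a nonnegative integer. Let $p(x)\in\mathbb{C}[x]$ with $\deg p(x)=n$, and let $g(t)=\frac{e^t+1}{2}$, $f(t)=\frac{1}{\lambda}(e^{\lambda t}-1)$. Then $p(x)=\sum_{k=0}^{n}a_k\,\mathcal{E}^{(r)}_{k,\lambda}(x)$, where for $k=0,\dots,n$, \begin{align*} a_k&=\frac{1}{k!}g(t)^r f(t)^k p(x)\Big|_{x=0} =\frac{1}{2^r k!\,\lambda^k}\tilde\Delta^r\Delta_\lambda^k p(0)\\ &=\frac{1}{2^r k!\,\lambda^k}\sum_{j=0}^{r}\sum_{l=0}^{k}\binom{r}{j}\binom{k}{l}(-1)^{k-l}p(j+l\lambda)\\ &=\frac{1}{2^r\lambda^k}\sum_{j=0}^{r}\sum_{l=k}^{n}\binom{r}{j}\frac{\lambda^l}{l!}S_2(l,k)\,p^{(l)}(j), \end{align*} and, when $r\ge1$, also $a_k=\frac{1}{2^r k!\,\lambda^k}\tilde\Delta^{r-1}\Delta_\lambda^k\big(p(x+1)+p(x)\big)\big|_{x=0}$.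
   Context: The degenerate exponential is $e_\lambda^x(t)=(1+\lambda t)^{x/\lambda}$, $e_\lambda(t)=e_\lambda^1(t)$. The degenerate Euler polynomials of order $r$ are defined by $\big(\frac{2}{e_\lambda(t)+1}\big)^r e_\lambda^x(t)=\sum_{n\ge0}\mathcal{E}^{(r)}_{n,\lambda}(x)\frac{t^n}{n!}$. A formal power series $F(t)$ acts on polynomials as a differential operator via $t^k x^m=(m)_k x^{m-k}$ (i.e. $t=d/dx$, so $e^{yt}q(x)=q(x+y)$). For a polynomial $q$: $\Delta_\lambda^k q(x)=\sum_{i=0}^k\binom{k}{i}(-1)^{k-i}q(x+i\lambda)$, $\tilde\Delta^r q(x)=\sum_{i=0}^r\binom{r}{i}q(x+i)$, and $\tilde\Delta^r\Delta_\lambda^k p(0)$ means $(\tilde\Delta^r\Delta_\lambda^k p)(x)$ at $x=0$. $p^{(l)}$ is the $l$-th derivative; $S_2(l,k)$ are Stirling numbers of the second kind, $\frac{1}{k!}(e^t-1)^k=\sum_{l\ge k}S_2(l,k)\frac{t^l}{l!}$. *)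

theory Defs
  imports
    "HOL-Computational_Algebra.Computational_Algebra"
    "HOL-Combinatorics.Stirling"
begin

text \<open>The degenerate exponential $(1+\lambda t)^{x/\lambda}$, as the binomial series with exponent
  $x/\lambda$ in which $\lambda t$ is substituted for the variable.\<close>

definition degenerate_exp :: "complex \<Rightarrow> complex \<Rightarrow> complex fps" where
  "degenerate_exp lam x = fps_compose (fps_binomial (x / lam)) (fps_const lam * fps_X)"

definition degenerate_euler_gf :: "complex \<Rightarrow> nat \<Rightarrow> complex \<Rightarrow> complex fps" where
  "degenerate_euler_gf lam r x = (2 / (degenerate_exp lam 1 + 1)) ^ r * degenerate_exp lam x"

text \<open>The coefficient of $t^n/n!$ in the generating function is a polynomial in \<open>x\<close>; existence and
  uniqueness are established in \<open>poly_degenerate_euler_poly\<close> below.\<close>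

definition degenerate_euler_poly :: "complex \<Rightarrow> nat \<Rightarrow> nat \<Rightarrow> complex poly" where
  "degenerate_euler_poly lam r n =
     (THE q. \<forall>x. poly q x = fact n * fps_nth (degenerate_euler_gf lam r x) n)"

lemma degenerate_exp_nth:
  "fps_nth (degenerate_exp lam x) n = lam ^ n * ((x / lam) gchoose n)"
  unfolding degenerate_exp_def by simp

lemma degenerate_euler_poly_exists:
  "\<exists>q. \<forall>x. poly q x = fact n * fps_nth (degenerate_euler_gf lam r x) n"
proof -
  define A where "A = (2 / (degenerate_exp lam 1 + 1)) ^ r"
  define B :: "nat \<Rightarrow> complex poly" where
    "B m = smult (lam ^ m / fact m) (\<Prod>j<m. [:- of_nat j, 1 / lam:])" for m
  have B: "poly (B m) x = fps_nth (degenerate_exp lam x) m" for m x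
    by (simp add: B_def degenerate_exp_nth gbinomial_prod_rev poly_prod atLeast0LessThan)
  have "poly (smult (fact n) (\<Sum>i=0..n. smult (fps_nth A i) (B (n - i)))) x
      = fact n * fps_nth (degenerate_euler_gf lam r x) n" for x
    by (simp add: degenerate_euler_gf_def A_def [symmetric] fps_mult_nth poly_sum B)
  then show ?thesis by blast
qed

lemma poly_degenerate_euler_poly:
  "poly (degenerate_euler_poly lam r n) x = fact n * fps_nth (degenerate_euler_gf lam r x) n"
proof -
  have "\<exists>!q. \<forall>x. poly q x = fact n * fps_nth (degenerate_euler_gf lam r x) n"
    using degenerate_euler_poly_exists [of n lam r]
    by (metis ext poly_eq_poly_eq_iff)
  from theI' [OF this] show ?thesis
    unfolding degenerate_euler_poly_def by blast
qed

text \<open>The action of $F(t) = \sum_k c_k t^k$ on polynomials with $t = d/dx$. The sum stops at the degree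
  of \<open>q\<close> because all higher derivatives of \<open>q\<close> vanish.\<close>

definition fps_operator :: "complex fps \<Rightarrow> complex poly \<Rightarrow> complex poly" where
  "fps_operator F q = (\<Sum>k\<le>degree q. smult (fps_nth F k) ((pderiv ^^ k) q))"

lemma fps_operator_eq_sum:
  assumes "degree q \<le> N"
  shows "fps_operator F q = (\<Sum>k\<le>N. smult (fps_nth F k) ((pderiv ^^ k) q))"
  unfolding fps_operator_def
proof (rule sum.mono_neutral_left)
  show "\<forall>k\<in>{..N} - {..degree q}. smult (fps_nth F k) ((pderiv ^^ k) q) = 0"
  proof
    fix k assume "k \<in> {..N} - {..degree q}"
    then have k: "degree q < k" by auto
    have "coeff ((pderiv ^^ k) q) i = 0" for i
      unfolding coeff_higher_pderiv using k by (simp add: coeff_eq_0)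
    then have "(pderiv ^^ k) q = 0" by (simp add: poly_eq_iff)
    then show "smult (fps_nth F k) ((pderiv ^^ k) q) = 0" by simp
  qed
qed (use assms in auto)

lemma higher_pderiv_monom_falling:
  "(pderiv ^^ k) (monom c m :: complex poly) =
     monom (c * (\<Prod>i<k. of_nat m - of_nat i)) (m - k)"
proof (induction k)
  case (Suc k)
  show ?case
  proof (cases "k \<le> m")
    case True
    then show ?thesis
      by (simp add: Suc.IH pderiv_monom of_nat_diff mult.commute mult.left_commute)
  next
    case False
    then have "(\<Prod>i<k. of_nat m - of_nat i :: complex) = 0"
      by (intro prod_zero) auto
    then show ?thesis
      by (simp only: Suc.IH funpow.simps o_apply prod.lessThan_Suc mult_zero_left mult_zero_right
        monom_eq_0 pderiv_0)
  qed
qed simp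

lemma fps_operator_X_power_monom:
  "fps_operator (fps_X ^ k) (monom 1 m) =
     monom (\<Prod>i<k. of_nat m - of_nat i) (m - k)"
proof -
  have "fps_operator (fps_X ^ k) (monom 1 m) =
      (\<Sum>j\<le>max k m. smult (if j = k then 1 else 0) ((pderiv ^^ j) (monom 1 m)))"
    by (subst fps_operator_eq_sum [where N = "max k m"]) (auto simp: degree_monom_eq fps_X_power_iff)
  also have "\<dots> = (\<Sum>j\<le>max k m. if j = k then (pderiv ^^ k) (monom 1 m) else 0)"
    by (intro sum.cong) auto
  also have "\<dots> = (pderiv ^^ k) (monom 1 m)" by simp
  finally show ?thesis by (simp add: higher_pderiv_monom_falling)
qed

lemma fps_operator_exp: "fps_operator (fps_exp y) q = q \<circ>\<^sub>p [:y, 1:]"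
proof -
  define N where "N = degree q"
  have monom: "(\<Sum>k\<le>N. y ^ k / fact k * poly ((pderiv ^^ k) (monom c m)) x) = c * (x + y) ^ m"
    if "m \<le> N" for c x m
  proof -
    have "(\<Sum>k\<le>N. y ^ k / fact k * poly ((pderiv ^^ k) (monom c m)) x) =
        (\<Sum>k\<le>N. c * (of_nat (m choose k) * y ^ k * x ^ (m - k)))"
      by (intro sum.cong)
        (simp_all add: higher_pderiv_monom_falling poly_monom binomial_gbinomial
          gbinomial_prod_rev atLeast0LessThan)
    also have "\<dots> = (\<Sum>k\<le>m. c * (of_nat (m choose k) * y ^ k * x ^ (m - k)))"
      using that by (intro sum.mono_neutral_right) auto
    also have "\<dots> = c * (y + x) ^ m"
      by (simp add: binomial_ring sum_distrib_left)
    finally show ?thesis by (simp add: add.commute)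
  qed
  have "poly (fps_operator (fps_exp y) q) x = poly (q \<circ>\<^sub>p [:y, 1:]) x" for x
  proof -
    have "poly (fps_operator (fps_exp y) q) x =
        (\<Sum>k\<le>N. y ^ k / fact k * poly ((pderiv ^^ k) (\<Sum>m\<le>N. monom (coeff q m) m)) x)"
      by (simp add: fps_operator_def N_def poly_sum poly_as_sum_of_monoms)
    also have "\<dots> = (\<Sum>k\<le>N. \<Sum>m\<le>N. y ^ k / fact k * poly ((pderiv ^^ k) (monom (coeff q m) m)) x)"
      by (simp add: higher_pderiv_sum poly_sum sum_distrib_left)
    also have "\<dots> = (\<Sum>m\<le>N. \<Sum>k\<le>N. y ^ k / fact k * poly ((pderiv ^^ k) (monom (coeff q m) m)) x)"
      by (rule sum.swap)
    also have "\<dots> = (\<Sum>m\<le>N. coeff q m * (x + y) ^ m)"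
      by (rule sum.cong, rule refl, rule monom) simp
    also have "\<dots> = poly q (x + y)"
      by (simp add: poly_altdef N_def)
    finally show ?thesis by (simp add: poly_pcompose add.commute)
  qed
  then show ?thesis by (metis ext poly_eq_poly_eq_iff)
qed

definition lambda_diff :: "complex \<Rightarrow> nat \<Rightarrow> complex poly \<Rightarrow> complex poly" where
  "lambda_diff lam k q =
     (\<Sum>i\<le>k. smult (of_nat (k choose i) * (-1) ^ (k - i)) (q \<circ>\<^sub>p [:of_nat i * lam, 1:]))"

definition sum_diff :: "nat \<Rightarrow> complex poly \<Rightarrow> complex poly" where
  "sum_diff r q = (\<Sum>i\<le>r. smult (of_nat (r choose i)) (q \<circ>\<^sub>p [:of_nat i, 1:]))"

text \<open>\<open>Stirling\<close> is defined by its recurrence; it satisfies the generating function identity.\<close>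

lemma Stirling_gf:
  "fps_const (1 / fact k) * (fps_exp 1 - 1) ^ k =
     Abs_fps (\<lambda>l. of_nat (Stirling l k) / fact l :: complex)"
proof -
  define G :: "nat \<Rightarrow> complex fps" where
    "G k = fps_const (1 / fact k) * (fps_exp 1 - 1) ^ k" for k
  have deriv: "fps_deriv (G (Suc k)) = fps_const (of_nat (Suc k)) * G (Suc k) + G k" for k
  proof -
    define E :: "complex fps" where "E = fps_exp 1 - 1"
    have dE: "fps_deriv E = E + 1" by (simp add: E_def)
    have c: "fps_const (1 / fact (Suc k)) * fps_const (of_nat (Suc k)) =
        (fps_const (1 / fact k) :: complex fps)"
      by (simp only: fps_const_mult) (simp add: field_simps del: of_nat_Suc)
    have "fps_deriv (G (Suc k)) =
        (fps_const (1 / fact (Suc k)) * fps_const (of_nat (Suc k))) * ((E + 1) * E ^ k)"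
      by (simp add: G_def E_def [symmetric] fps_deriv_power dE mult.assoc del: fps_const_mult fact_Suc power_Suc of_nat_Suc)
    also have "\<dots> = (fps_const (1 / fact (Suc k)) * fps_const (of_nat (Suc k))) * E ^ Suc k
        + fps_const (1 / fact k) * E ^ k"
      by (simp only: c power_Suc) (simp add: algebra_simps)
    finally show ?thesis
      by (simp only: G_def E_def [symmetric] mult_ac)
  qed
  have "fps_nth (G k) l = of_nat (Stirling l k) / fact l" for l
  proof (induction l k rule: Stirling.induct)
    case (4 l k)
    have "of_nat (Suc l) * fps_nth (G (Suc k)) (Suc l) =
        of_nat (Suc k) * fps_nth (G (Suc k)) l + fps_nth (G k) l"
      using arg_cong [OF deriv [of k], of "\<lambda>F. fps_nth F l"]
      by (simp del: of_nat_Suc)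
    then have "of_nat (Suc l) * fps_nth (G (Suc k)) (Suc l) =
        of_nat (Stirling (Suc l) (Suc k)) / fact l"
      by (simp add: 4 add_divide_distrib del: of_nat_Suc) (simp add: field_simps)
    then have "fps_nth (G (Suc k)) (Suc l) =
        of_nat (Stirling (Suc l) (Suc k)) / fact l / of_nat (Suc l)"
      by (metis nonzero_mult_div_cancel_left of_nat_neq_0)
    then show ?case by (simp only: fact_Suc divide_divide_eq_left mult.commute of_nat_mult)
  qed (simp_all add: G_def)
  then show ?thesis by (simp add: fps_eq_iff G_def)
qed

end

theory Submission
  imports Defs
begin

text \<open>With \<open>t = d/dx\<close>, the operators \<open>f(t)\<close> and \<open>g(t)\<close> act on the degenerate Euler polynomials by
  \<open>f E\<^sub>j = j E\<^sub>j\<^sub>-\<^sub>1\<close> and by lowering the order \<open>r\<close> by one; both are read off the generating function, since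
  shifting \<open>x\<close> by \<open>\<lambda>\<close> multiplies it by \<open>1 + \<lambda>t\<close>. Order zero gives a generating function equal to 1
  at \<open>x = 0\<close>, so the functionals \<open>g\<^sup>r f\<^sup>k(\<cdot>)|\<^sub>x\<^sub>=\<^sub>0 / k!\<close> are dual to the \<open>E\<^sub>k\<close>. The \<open>E\<^sub>k\<close> span: \<open>f\<close>
  lowers the degree, and its kernel consists of the polynomials of period \<open>\<lambda>\<close>, that is, the constants.
  The other formulas for the coefficients expand \<open>g\<^sup>r f\<^sup>k\<close> in exponentials or in powers of \<open>t\<close>.\<close>

section \<open>The operator calculus\<close>

lemma smult_sum_right: "smult c (sum F A) = (\<Sum>i\<in>A. smult c (F i))"
  by (induction A rule: infinite_finite_induct) (simp_all add: smult_add_right)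

lemma higher_pderiv_eq_0:
  fixes q :: "complex poly"
  assumes "degree q < k"
  shows "(pderiv ^^ k) q = 0"
  using assms by (simp add: poly_eq_iff coeff_higher_pderiv coeff_eq_0)

lemma fps_operator_add_left: "fps_operator (F + G) q = fps_operator F q + fps_operator G q"
  by (simp add: fps_operator_def smult_add_left sum.distrib)

lemma fps_operator_diff_left: "fps_operator (F - G) q = fps_operator F q - fps_operator G q"
  by (simp add: fps_operator_def smult_diff_left sum_subtractf)

lemma fps_operator_const_mult: "fps_operator (fps_const c * F) q = smult c (fps_operator F q)"
  by (simp add: fps_operator_def smult_sum_right)

lemma fps_operator_sum_left: "fps_operator (sum F A) q = (\<Sum>i\<in>A. fps_operator (F i) q)"
  by (induction A rule: infinite_finite_induct)
    (simp_all add: fps_operator_add_left, simp_all add: fps_operator_def)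

lemma fps_operator_1: "fps_operator 1 q = q"
  using fps_operator_exp [of 0 q] by (simp add: pcompose_idR)

lemma fps_operator_add_right: "fps_operator F (p + q) = fps_operator F p + fps_operator F q"
proof -
  define N where "N = max (degree p) (degree q)"
  have "degree p \<le> N" "degree q \<le> N" "degree (p + q) \<le> N"
    by (auto simp: N_def degree_add_le)
  then show ?thesis
    by (simp add: fps_operator_eq_sum [where N = N] higher_pderiv_add smult_add_right sum.distrib)
qed

lemma fps_operator_smult: "fps_operator F (smult c q) = smult c (fps_operator F q)"
  by (simp add: fps_operator_eq_sum [where N = "degree q"] higher_pderiv_smult smult_sum_right
      mult.commute)

lemma fps_operator_0_right: "fps_operator F 0 = 0"
  using fps_operator_smult [of F 0 0] by simp

lemma fps_operator_sum_right: "fps_operator F (sum q A) = (\<Sum>i\<in>A. fps_operator F (q i))"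
  by (induction A rule: infinite_finite_induct)
    (simp_all add: fps_operator_add_right fps_operator_0_right)

lemma higher_pderiv_fps_operator:
  assumes "degree q \<le> N"
  shows "(pderiv ^^ i) (fps_operator G q) = (\<Sum>j\<le>N. smult (fps_nth G j) ((pderiv ^^ (i + j)) q))"
  by (simp add: fps_operator_eq_sum [OF assms] higher_pderiv_sum higher_pderiv_smult funpow_add)

lemma degree_fps_operator_le: "degree (fps_operator F q) \<le> degree q"
  unfolding fps_operator_def
  by (intro degree_sum_le) (auto simp: degree_higher_pderiv intro: order.trans [OF degree_smult_le])

text \<open>Regrouping the double sum by total order \<open>i + j\<close> produces the Cauchy
  product. Power series thus act as a commutative ring, so \<open>g\<close> and \<open>f\<close> may
  be applied in either order.\<close>

lemma fps_operator_mult: "fps_operator (F * G) q = fps_operator F (fps_operator G q)"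
proof -
  define N where "N = degree q"
  have "fps_operator F (fps_operator G q) =
      (\<Sum>i\<le>N. \<Sum>j\<le>N. smult (fps_nth F i * fps_nth G j) ((pderiv ^^ (i + j)) q))"
    by (simp add: fps_operator_eq_sum [OF degree_fps_operator_le]
        higher_pderiv_fps_operator [OF order.refl] smult_sum_right N_def)
  also have "\<dots> = (\<Sum>(i, j)\<in>{..N} \<times> {..N}. smult (fps_nth F i * fps_nth G j) ((pderiv ^^ (i + j)) q))"
    by (simp add: sum.cartesian_product)
  \<comment> \<open>Outside the triangle the order of differentiation exceeds the degree of
    \<open>q\<close>.\<close>
  also have "\<dots> = (\<Sum>(i, j)\<in>{(i, j). i + j \<le> N}.
      smult (fps_nth F i * fps_nth G j) ((pderiv ^^ (i + j)) q))"
    by (rule sum.mono_neutral_right) (auto simp: N_def, metis higher_pderiv_eq_0 not_le)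
  also have "\<dots> = (\<Sum>k\<le>N. \<Sum>i\<le>k. smult (fps_nth F i * fps_nth G (k - i)) ((pderiv ^^ k) q))"
    by (subst sum.triangle_reindex_eq) (intro sum.cong refl; simp)
  also have "\<dots> = fps_operator (F * G) q"
    by (simp add: fps_operator_def N_def fps_mult_nth smult_sum atLeast0AtMost)
  finally show ?thesis ..
qed

section \<open>Difference operators as powers of exponential series\<close>

lemma fps_exp_diff_1_power:
  "(fps_exp L - 1) ^ k =
    (\<Sum>i\<le>k. fps_const (of_nat (k choose i) * (-1) ^ (k - i)) * fps_exp (of_nat i * L :: complex))"
proof -
  have "(fps_exp L - 1) ^ k = (fps_exp L + (-1)) ^ k"
    by simp
  also have "\<dots> = (\<Sum>i\<le>k. of_nat (k choose i) * fps_exp L ^ i * (-1) ^ (k - i))"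
    by (rule binomial_ring)
  also have "\<dots> = (\<Sum>i\<le>k. fps_const (of_nat (k choose i) * (-1) ^ (k - i)) * fps_exp (of_nat i * L))"
    by (intro sum.cong refl)
      (simp add: fps_exp_power_mult fps_of_nat [symmetric] fps_const_mult [symmetric]
        fps_const_power [symmetric] fps_const_neg [symmetric] mult_ac
        del: fps_const_mult fps_const_power fps_const_neg)
  finally show ?thesis .
qed

lemma fps_exp_plus_1_power:
  "(fps_exp 1 + 1) ^ r =
    (\<Sum>i\<le>r. fps_const (of_nat (r choose i)) * fps_exp (of_nat i :: complex))"
  by (simp add: binomial_ring fps_exp_power_mult fps_of_nat)

text \<open>Each shift by \<open>of_nat i * L\<close> is the action of an exponential, so the
  binomial theorem collects the shifts into a power.\<close>

lemma lambda_diff_eq_fps_operator: "lambda_diff L k q = fps_operator ((fps_exp L - 1) ^ k) q"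
  by (simp add: lambda_diff_def fps_exp_diff_1_power fps_operator_sum_left fps_operator_const_mult
      fps_operator_exp)

lemma sum_diff_eq_fps_operator: "sum_diff r q = fps_operator ((fps_exp 1 + 1) ^ r) q"
  by (simp add: sum_diff_def fps_exp_plus_1_power fps_operator_sum_left fps_operator_const_mult
      fps_operator_exp)

text \<open>This is the generating function of the Stirling numbers with \<open>L * t\<close>
  substituted for \<open>t\<close>.\<close>

lemma fps_nth_exp_diff_1_power:
  "fps_nth ((fps_exp L - 1) ^ k) l = fact k * (L ^ l / fact l * of_nat (Stirling l k) :: complex)"
proof -
  have "(fps_exp L - 1) ^ k =
      fps_compose ((fps_exp (1 :: complex) - 1) ^ k) (fps_const L * fps_X)"
    by (simp add: fps_compose_power [symmetric] fps_compose_sub_distrib)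
  moreover have "(fps_exp (1 :: complex) - 1) ^ k =
      fps_const (fact k) * (fps_const (1 / fact k) * (fps_exp 1 - 1) ^ k)"
    by (simp add: mult.assoc [symmetric])
  ultimately show ?thesis
    unfolding Stirling_gf by (simp add: fps_nth_compose_linear)
qed

section \<open>The degenerate Euler polynomials\<close>

lemma degenerate_exp_add: "degenerate_exp L (x + y) = degenerate_exp L x * degenerate_exp L y"
  by (simp add: degenerate_exp_def add_divide_distrib fps_binomial_add_mult
      fps_compose_mult_distrib)

lemma degenerate_exp_self:
  assumes "L \<noteq> 0"
  shows "degenerate_exp L L = 1 + fps_const L * fps_X"
  using assms by (simp add: degenerate_exp_def fps_binomial_1 fps_compose_add_distrib)

lemma degenerate_exp_0: "degenerate_exp L 0 = 1"
  by (simp add: degenerate_exp_def)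

text \<open>Shifting \<open>x\<close> by \<open>L\<close> multiplies the generating function by
  \<open>1 + L * t\<close>, so the difference quotient multiplies it by \<open>t\<close>. At
  \<open>k = 0\<close> the truncated index \<open>k - 1\<close> does no harm, since the factor
  \<open>of_nat k\<close> vanishes.\<close>

lemma fps_operator_delta_degenerate_euler_poly:
  fixes L :: complex
  assumes "L \<noteq> 0"
  shows "fps_operator (fps_const (1 / L) * (fps_exp L - 1)) (degenerate_euler_poly L r k) =
    smult (of_nat k) (degenerate_euler_poly L r (k - 1))" (is "?l = ?r")
proof -
  have "poly ?l x = poly ?r x" for x
  proof -
    have "degenerate_euler_gf L r (x + L) =
        degenerate_euler_gf L r x + fps_const L * (fps_X * degenerate_euler_gf L r x)"
      by (simp add: degenerate_euler_gf_def degenerate_exp_add degenerate_exp_self assms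
          algebra_simps)
    then have "fps_nth (degenerate_euler_gf L r (x + L)) k - fps_nth (degenerate_euler_gf L r x) k =
        L * fps_nth (fps_X * degenerate_euler_gf L r x) k"
      by simp
    moreover have "poly ?l x = fact k *
        ((fps_nth (degenerate_euler_gf L r (x + L)) k - fps_nth (degenerate_euler_gf L r x) k) / L)"
      by (simp add: fps_operator_const_mult fps_operator_diff_left fps_operator_exp fps_operator_1
          poly_pcompose poly_degenerate_euler_poly add.commute)
        (simp add: right_diff_distrib)
    ultimately have "poly ?l x = fact k * fps_nth (fps_X * degenerate_euler_gf L r x) k"
      using assms by simp
    also have "\<dots> = poly ?r x"
      by (cases k) (simp_all add: poly_degenerate_euler_poly)
    finally show ?thesis .
  qed
  then show ?thesis by (metis ext poly_eq_poly_eq_iff)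
qed

text \<open>Adding the shift by 1 to the identity multiplies the generating function by
  \<open>degenerate_exp L 1 + 1\<close>, which cancels one of the \<open>Suc r\<close>
  denominators.\<close>

lemma fps_operator_mean_degenerate_euler_poly:
  "fps_operator (fps_const (1 / 2) * (fps_exp 1 + 1)) (degenerate_euler_poly L (Suc r) k) =
    degenerate_euler_poly L r k" (is "?l = ?r")
proof -
  have "poly ?l x = poly ?r x" for x
  proof -
    define E where "E = degenerate_exp L 1 + 1"
    \<comment> \<open>The constant term is 2, so \<open>E\<close> is a unit and dividing by it is
      genuine inversion.\<close>
    have "fps_nth E 0 \<noteq> 0"
      by (simp add: E_def degenerate_exp_nth)
    then have "2 / E * E = 2"
      by (simp add: fps_divide_unit mult.assoc inverse_mult_eq_1)
    moreover have "degenerate_euler_gf L (Suc r) (x + 1) + degenerate_euler_gf L (Suc r) x =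
        2 / E * E * degenerate_euler_gf L r x"
    proof -
      have "degenerate_euler_gf L s y = (2 / E) ^ s * degenerate_exp L y" for s y
        by (simp add: degenerate_euler_gf_def E_def)
      moreover have "degenerate_exp L (x + 1) + degenerate_exp L x = E * degenerate_exp L x"
        by (simp add: degenerate_exp_add E_def algebra_simps)
      ultimately show ?thesis
        by (simp only: distrib_left [symmetric] power_Suc) (simp only: mult_ac)
    qed
    ultimately have "fps_nth (degenerate_euler_gf L (Suc r) (x + 1)) k +
        fps_nth (degenerate_euler_gf L (Suc r) x) k = 2 * fps_nth (degenerate_euler_gf L r x) k"
      by (metis fps_add_nth mult_2)
    then show ?thesis
      by (simp add: fps_operator_const_mult fps_operator_add_left fps_operator_exp fps_operator_1
          poly_pcompose poly_degenerate_euler_poly add.commute distrib_left [symmetric])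
  qed
  then show ?thesis by (metis ext poly_eq_poly_eq_iff)
qed

lemma fps_operator_mean_power_degenerate_euler_poly:
  assumes "g = fps_const (1 / 2) * (fps_exp 1 + 1)"
  shows "fps_operator (g ^ r) (degenerate_euler_poly L r k) = degenerate_euler_poly L 0 k"
  by (induction r)
    (simp_all only: power_0 power_Suc2 fps_operator_1 fps_operator_mult
      fps_operator_mean_degenerate_euler_poly [folded assms])

text \<open>Each \<open>f\<close> lowers the index and contributes it as a factor. If
  \<open>j < k\<close> the factor 0 occurs; if \<open>j > k\<close> a polynomial of positive index
  is left, whose value at 0 vanishes because the generating function of order zero is 1
  there.\<close>

lemma poly_0_fps_operator_delta_power_degenerate_euler_poly:
  assumes "L \<noteq> 0" and f: "f = fps_const (1 / L) * (fps_exp L - 1)"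
  shows "poly (fps_operator (f ^ k) (degenerate_euler_poly L 0 j)) 0 = (if j = k then fact k else 0)"
proof (induction k arbitrary: j)
  case 0
  show ?case
    by (simp add: fps_operator_1 poly_degenerate_euler_poly degenerate_euler_gf_def
        degenerate_exp_0)
next
  case (Suc k)
  show ?case
    by (cases j) (simp_all only: power_Suc2 fps_operator_mult fps_operator_smult
      fps_operator_delta_degenerate_euler_poly [OF assms(1), folded f] poly_smult Suc.IH, simp_all)
qed

lemma degenerate_euler_poly_0: "degenerate_euler_poly L r 0 = 1"
proof -
  have "fps_nth (2 / (degenerate_exp L 1 + 1)) 0 = 1"
    by (simp add: fps_divide_nth_0 degenerate_exp_nth)
  then have "poly (degenerate_euler_poly L r 0) x = poly 1 x" for x
    by (simp add: poly_degenerate_euler_poly degenerate_euler_gf_def degenerate_exp_nth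
        fps_nth_power_0)
  then show ?thesis by (metis ext poly_eq_poly_eq_iff)
qed

section \<open>Spanning and the expansion\<close>

lemma periodic_poly_constant:
  fixes q :: "'a :: field_char_0 poly"
  assumes "c \<noteq> 0" and "\<And>x. poly q (x + c) = poly q x"
  shows "q = [:poly q 0:]"
proof (rule ccontr)
  assume "q \<noteq> [:poly q 0:]"
  then have "finite {x. poly (q - [:poly q 0:]) x = 0}"
    by (intro poly_roots_finite) simp
  \<comment> \<open>In characteristic zero these multiples of \<open>c\<close> are infinitely many
    roots of \<open>q - [:poly q 0:]\<close>.\<close>
  moreover have "poly q (of_nat m * c) = poly q 0" for m
    by (induction m) (simp_all add: distrib_right add.commute [of c] assms(2))
  then have "range (\<lambda>m. of_nat m * c) \<subseteq> {x. poly (q - [:poly q 0:]) x = 0}"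
    by auto
  ultimately have "finite (range (\<lambda>m :: nat. of_nat m * c))"
    by (rule rev_finite_subset)
  moreover have "inj (\<lambda>m :: nat. of_nat m * c)"
    using assms(1) by (auto simp: inj_def)
  ultimately show False
    using finite_imageD infinite_UNIV_nat by blast
qed

lemma degree_fps_operator_less:
  assumes "fps_nth F 0 = 0" and "degree q \<le> Suc n"
  shows "degree (fps_operator F q) \<le> n"
  unfolding fps_operator_def
proof (intro degree_sum_le)
  fix k
  show "degree (smult (fps_nth F k) ((pderiv ^^ k) q)) \<le> n"
    using assms by (cases k) (auto simp: degree_higher_pderiv simp del: funpow.simps)
qed simp

lemma degenerate_euler_poly_span:
  fixes L :: complex
  assumes "L \<noteq> 0" and "degree q \<le> n"
  shows "\<exists>a. q = (\<Sum>k\<le>n. smult (a k) (degenerate_euler_poly L r k))"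
  using assms(2)
proof (induction n arbitrary: q)
  case 0
  then obtain c where "q = [:c:]"
    by (auto elim: degree_eq_zeroE)
  then show ?case
    by (intro exI [of _ "\<lambda>_. c"]) (simp add: degenerate_euler_poly_0)
next
  case (Suc n)
  define f where "f = fps_const (1 / L) * (fps_exp L - 1)"
  have f_0: "fps_nth f 0 = 0"
    by (simp add: f_def)
  obtain c where c: "fps_operator f q = (\<Sum>k\<le>n. smult (c k) (degenerate_euler_poly L r k))"
    using Suc.IH [OF degree_fps_operator_less [of f q n]] Suc.prems f_0 by auto
  \<comment> \<open>Since \<open>f\<close> sends the polynomial of index \<open>Suc k\<close> to
    \<open>Suc k\<close> times that of index \<open>k\<close>, this is a preimage of
    \<open>fps_operator f q\<close> under \<open>f\<close>.\<close>
  define s where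
    "s = (\<Sum>k\<le>n. smult (c k / of_nat (Suc k)) (degenerate_euler_poly L r (Suc k)))"
  have "fps_operator f s = (\<Sum>k\<le>n. smult (c k) (degenerate_euler_poly L r k))"
    unfolding s_def fps_operator_sum_right fps_operator_smult f_def
      fps_operator_delta_degenerate_euler_poly [OF assms(1)]
    by (simp del: of_nat_Suc)
  with c have "smult L (fps_operator f q) = smult L (fps_operator f s)"
    by simp
  then have "q \<circ>\<^sub>p [:L, 1:] - q = s \<circ>\<^sub>p [:L, 1:] - s"
    using assms(1)
    by (simp add: f_def fps_operator_const_mult fps_operator_diff_left fps_operator_exp
        fps_operator_1)
  then have eq: "poly (q \<circ>\<^sub>p [:L, 1:] - q) x = poly (s \<circ>\<^sub>p [:L, 1:] - s) x" for x
    by simp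
  \<comment> \<open>The kernel of \<open>f\<close> consists of the \<open>L\<close>-periodic
    polynomials.\<close>
  have "poly (q - s) (x + L) = poly (q - s) x" for x
    using eq [of x] by (simp add: poly_pcompose algebra_simps)
  then have "q - s = [:poly (q - s) 0:]"
    by (rule periodic_poly_constant [OF assms(1)])
  then have "q = smult (poly (q - s) 0) 1 + s"
    by (metis diff_add_cancel smult_one)
  \<comment> \<open>The constant \<open>q - s\<close> becomes the coefficient of the polynomial of
    index 0, which is 1.\<close>
  then have "q = (\<Sum>k\<le>Suc n. smult (case k of 0 \<Rightarrow> poly (q - s) 0 | Suc m \<Rightarrow> c m / of_nat (Suc m))
      (degenerate_euler_poly L r k))"
    by (simp only: sum.atMost_Suc_shift nat.case degenerate_euler_poly_0 s_def [symmetric])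
  then show ?case by blast
qed

lemma degenerate_euler_poly_expansion:
  fixes L :: complex
  assumes "L \<noteq> 0" and "degree p \<le> n"
    and g: "g = fps_const (1 / 2) * (fps_exp 1 + 1)"
    and f: "f = fps_const (1 / L) * (fps_exp L - 1)"
  shows "p = (\<Sum>k\<le>n. smult (1 / fact k * poly (fps_operator (g ^ r * f ^ k) p) 0)
    (degenerate_euler_poly L r k))"
proof -
  obtain a where a: "p = (\<Sum>j\<le>n. smult (a j) (degenerate_euler_poly L r j))"
    using degenerate_euler_poly_span [OF assms(1,2)] by blast
  have dual: "poly (fps_operator (g ^ r * f ^ k) (degenerate_euler_poly L r j)) 0 =
      (if j = k then fact k else 0)" for j k
    \<comment> \<open>Commuting lets \<open>g ^ r\<close> act first and bring the order down to 0,
      where the duality for \<open>f ^ k\<close> applies.\<close>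
    by (simp only: mult.commute [of "g ^ r"] fps_operator_mult
        fps_operator_mean_power_degenerate_euler_poly [OF g]
        poly_0_fps_operator_delta_power_degenerate_euler_poly [OF assms(1) f])
  have "a k = 1 / fact k * poly (fps_operator (g ^ r * f ^ k) p) 0" if "k \<le> n" for k
    using that
    by (subst a) (simp add: fps_operator_sum_right fps_operator_smult poly_sum dual if_distrib cong: if_cong)
  then show ?thesis
    by (subst a) (intro sum.cong, simp_all)
qed

section \<open>The coefficients\<close>

lemma fps_operator_mean_delta_power:
  fixes L :: complex
  shows "fps_operator ((fps_const (1 / 2) * (fps_exp 1 + 1)) ^ r *
      (fps_const (1 / L) * (fps_exp L - 1)) ^ k) p =
    smult (1 / (2 ^ r * L ^ k)) (sum_diff r (lambda_diff L k p))"
proof -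
  have "(fps_const (1 / 2) * (fps_exp 1 + 1)) ^ r * (fps_const (1 / L) * (fps_exp L - 1)) ^ k =
      fps_const ((1 / 2) ^ r * (1 / L) ^ k) * ((fps_exp 1 + 1) ^ r * (fps_exp L - 1) ^ k)"
    by (simp only: power_mult_distrib fps_const_mult [symmetric] fps_const_power [symmetric] mult_ac)
  then show ?thesis
    by (simp only: fps_operator_const_mult)
      (simp add: fps_operator_mult sum_diff_eq_fps_operator lambda_diff_eq_fps_operator power_one_over)
qed

lemma poly_sum_diff: "poly (sum_diff r q) x = (\<Sum>j\<le>r. of_nat (r choose j) * poly q (of_nat j + x))"
  by (simp add: sum_diff_def poly_sum poly_pcompose)

lemma poly_lambda_diff:
  "poly (lambda_diff L k q) x =
    (\<Sum>l\<le>k. of_nat (k choose l) * (-1) ^ (k - l) * poly q (of_nat l * L + x))"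
  by (simp add: lambda_diff_def poly_sum poly_pcompose)

text \<open>Here the operator is expanded in powers of \<open>t\<close> instead of exponentials:
  terms beyond \<open>n\<close> vanish by degree, those below \<open>k\<close> because the Stirling
  numbers do.\<close>

lemma poly_lambda_diff_Stirling:
  assumes "degree q \<le> n"
  shows "poly (lambda_diff L k q) x =
    fact k * (\<Sum>l=k..n. L ^ l / fact l * of_nat (Stirling l k) * poly ((pderiv ^^ l) q) x)"
proof -
  have "poly (lambda_diff L k q) x =
      (\<Sum>l\<le>n. fact k * (L ^ l / fact l * of_nat (Stirling l k) * poly ((pderiv ^^ l) q) x))"
    by (simp add: lambda_diff_eq_fps_operator fps_operator_eq_sum [OF assms] poly_sum
        fps_nth_exp_diff_1_power mult.assoc)
  also have "\<dots> = (\<Sum>l=k..n. fact k * (L ^ l / fact l * of_nat (Stirling l k) * poly ((pderiv ^^ l) q) x))"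
    by (rule sum.mono_neutral_right) (auto simp: Stirling_less)
  finally show ?thesis by (simp add: sum_distrib_left)
qed

text \<open>One factor of \<open>(fps_exp 1 + 1) ^ Suc r\<close> is split off and, by commutativity,
  applied to \<open>p\<close> first.\<close>

lemma sum_diff_lambda_diff_Suc:
  "sum_diff (Suc r) (lambda_diff L k p) = sum_diff r (lambda_diff L k (p \<circ>\<^sub>p [:1, 1:] + p))"
proof -
  have "p \<circ>\<^sub>p [:1, 1:] + p = fps_operator (fps_exp 1 + 1) p"
    by (simp add: fps_operator_add_left fps_operator_exp fps_operator_1)
  then show ?thesis
    by (simp only: sum_diff_eq_fps_operator lambda_diff_eq_fps_operator fps_operator_mult [symmetric]
        power_Suc mult_ac)
qed

theorem theorem4p2:
  fixes lam :: real and L :: complex and r n :: nat and p :: "complex poly"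
    and f g :: "complex fps"
  assumes "lam \<noteq> 0"
    and "L = complex_of_real lam"
    and "degree p = n"
    and "g = fps_const (1 / 2) * (fps_exp 1 + 1)"
    and "f = fps_const (1 / L) * (fps_exp L - 1)"
  shows "\<exists>a :: nat \<Rightarrow> complex.
    p = (\<Sum>k\<le>n. smult (a k) (degenerate_euler_poly L r k)) \<and>
    (\<forall>k\<le>n.
      a k = 1 / fact k * poly (fps_operator (g ^ r * f ^ k) p) 0 \<and>
      a k = 1 / (2 ^ r * fact k * L ^ k) * poly (sum_diff r (lambda_diff L k p)) 0 \<and>
      a k = 1 / (2 ^ r * fact k * L ^ k) *
        (\<Sum>j=0..r. \<Sum>l=0..k. of_nat (r choose j) * of_nat (k choose l) * (-1) ^ (k - l) *
          poly p (of_nat j + of_nat l * L)) \<and>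
      a k = 1 / (2 ^ r * L ^ k) *
        (\<Sum>j=0..r. \<Sum>l=k..n. of_nat (r choose j) * (L ^ l / fact l) * of_nat (Stirling l k) *
          poly ((pderiv ^^ l) p) (of_nat j)) \<and>
      (r \<ge> 1 \<longrightarrow>
        a k = 1 / (2 ^ r * fact k * L ^ k) *
          poly (sum_diff (r - 1) (lambda_diff L k (p \<circ>\<^sub>p [:1, 1:] + p))) 0))"
proof -
  have L: "L \<noteq> 0" and deg: "degree p \<le> n"
    using assms(1-3) by simp_all
  \<comment> \<open>The operator formula serves as the definition; the remaining ones are derived
    from it.\<close>
  define a where "a k = 1 / fact k * poly (fps_operator (g ^ r * f ^ k) p) 0" for k
  have a: "a k = 1 / (2 ^ r * fact k * L ^ k) * poly (sum_diff r (lambda_diff L k p)) 0" for k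
    by (simp add: a_def assms(4,5) fps_operator_mean_delta_power)
  have "a k = 1 / (2 ^ r * fact k * L ^ k) *
        (\<Sum>j=0..r. \<Sum>l=0..k. of_nat (r choose j) * of_nat (k choose l) * (-1) ^ (k - l) *
          poly p (of_nat j + of_nat l * L))" for k
    by (simp add: a poly_sum_diff poly_lambda_diff sum_distrib_left atLeast0AtMost mult.assoc
        add.commute)
  moreover have "a k = 1 / (2 ^ r * L ^ k) *
        (\<Sum>j=0..r. \<Sum>l=k..n. of_nat (r choose j) * (L ^ l / fact l) * of_nat (Stirling l k) *
          poly ((pderiv ^^ l) p) (of_nat j))" for k
  proof -
    have "poly (sum_diff r (lambda_diff L k p)) 0 = fact k *
        (\<Sum>j=0..r. \<Sum>l=k..n. of_nat (r choose j) * (L ^ l / fact l) * of_nat (Stirling l k) *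
          poly ((pderiv ^^ l) p) (of_nat j))"
      by (simp add: poly_sum_diff poly_lambda_diff_Stirling [OF deg] sum_distrib_left
          atLeast0AtMost mult_ac)
    then show ?thesis by (simp add: a)
  qed
  moreover have "a k = 1 / (2 ^ r * fact k * L ^ k) *
          poly (sum_diff (r - 1) (lambda_diff L k (p \<circ>\<^sub>p [:1, 1:] + p))) 0" if "r \<ge> 1" for k
    using that sum_diff_lambda_diff_Suc [of "r - 1" L k p] by (simp add: a)
  moreover have "p = (\<Sum>k\<le>n. smult (a k) (degenerate_euler_poly L r k))"
    unfolding a_def by (rule degenerate_euler_poly_expansion [OF L deg assms(4,5)])
  ultimately show ?thesis
    using a a_def by blast
qed

end
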